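(* Let $a(x,t)$ and $\sigma(x,t)>0$ be real-valued smooth functions, $b(x,t)=b_t(x)=\sigma(x,t)^2$, and let $X_t$ and $Y_t$ be two real-valued processes each evolving according to the same stochastic differential equation $dX_t = a(X_t,t)\,dt+\sigma(X_t,t)\,dW_t$ (with $W_t$ standard Brownian motion), from possibly different initial distributions. Let $p_t$ and $q_t$ be the densities of $X_t$ and $Y_t$ respectively, and assume the standing regularity assumptions listed in the context. Then for $t>0$ $$\frac{d}{dt} K(p_t\,\|\,q_t) = -\frac12 J_{b_t}(p_t\,\|\,q_t).$$
   Context: KL divergence: $K(p\,\|\,q)=\int_{\mathbb{R}}p(x)\log\frac{p(x)}{q(x)}\,dx$. Relative Fisher information with respect to a positive function $\beta:\mathbb{R}\to(0,\infty)$: $J_\beta(p\,\|\,q)=\int_{\mathbb{R}}p(x)\,\beta(x)\left(\frac{\partial}{\partial x}\log\frac{p(x)}{q(x)}\right)^2dx$. Standing regularity assumptions: $a$ and $\sigma$ satisfy regularity and growth conditions (e.g. smooth and Lipschitz) under which the densities exist and both $p(x,t)=p_t(x)$ and $q(x,t)=q_t(x)$ satisfy the Fokker-Planck equation $\frac{\partial p}{\partial t}=-\frac{\partial}{\partial x}(a p)+\frac12\frac{\partial^2}{\partial x^2}(b p)$. Densities are positive, smooth and rapidly decreasing, in the sense that all integrals involved converge, one may differentiate under the integral sign, and every integration by parts (involving products of $a$, $b$, densities, ratios of densities and their logarithms, and their derivatives) has zero boundary terms. *)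

theory Defs
  imports "HOL-Probability.Probability"
begin

section \<open>Smooth functions\<close>

text \<open>
  \<open>C_on k S f\<close>: \<open>f\<close> is \<open>k\<close> times continuously differentiable on \<open>S\<close>.  It is only used for
  \<open>S = UNIV \<times> {0..}\<close> and \<open>S = UNIV \<times> {0<..}\<close>, where derivatives within \<open>S\<close> are unique; on the
  boundary line of the former the derivative in the second variable is one-sided.
\<close>

primrec C_on :: "nat \<Rightarrow> 'a::real_normed_vector set \<Rightarrow> ('a \<Rightarrow> 'b::real_normed_vector) \<Rightarrow> bool" where
  "C_on 0 S f \<longleftrightarrow> continuous_on S f"
| "C_on (Suc k) S f \<longleftrightarrow>
     f differentiable_on S \<and> (\<forall>v. C_on k S (\<lambda>z. frechet_derivative f (at z within S) v))"

definition smooth_on :: "'a::real_normed_vector set \<Rightarrow> ('a \<Rightarrow> 'b::real_normed_vector) \<Rightarrow> bool" where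
  "smooth_on S f \<longleftrightarrow> (\<forall>k. C_on k S f)"


section \<open>Brownian motion, It\^o integral, stochastic differential equations\<close>

text \<open>
  Filtrations and processes are indexed by all reals, as the library's locale \<open>filtration\<close> needs a
  linearly ordered index type, but nothing is required of processes at negative times, and any
  filtration on \<open>{0..}\<close> extends to negative times by its value at 0.
\<close>

definition filtered_prob_space :: "'w measure \<Rightarrow> (real \<Rightarrow> 'w measure) \<Rightarrow> bool" where
  "filtered_prob_space M F \<longleftrightarrow>
     prob_space M \<and> filtration (space M) F \<and> (\<forall>t. subalgebra M (F t))"

definition adapted_continuous ::
  "'w measure \<Rightarrow> (real \<Rightarrow> 'w measure) \<Rightarrow> (real \<Rightarrow> 'w \<Rightarrow> real) \<Rightarrow> bool" where
  "adapted_continuous M F X \<longleftrightarrow>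
     (\<forall>t\<ge>0. X t \<in> borel_measurable (F t)) \<and> (\<forall>w\<in>space M. continuous_on {0..} (\<lambda>t. X t w))"

definition standard_brownian_motion ::
  "'w measure \<Rightarrow> (real \<Rightarrow> 'w measure) \<Rightarrow> (real \<Rightarrow> 'w \<Rightarrow> real) \<Rightarrow> bool" where
  "standard_brownian_motion M F W \<longleftrightarrow>
     filtered_prob_space M F \<and> adapted_continuous M F W \<and> (AE w in M. W 0 w = 0) \<and>
     (\<forall>s\<ge>0. \<forall>t>s.
        distributed M lborel (\<lambda>w. W t w - W s w) (\<lambda>x. ennreal (normal_density 0 (sqrt (t - s)) x)) \<and>
        prob_space.indep_set M (sets (F s))
          {(\<lambda>w. W t w - W s w) -` A \<inter> space M | A. A \<in> sets borel})"

text \<open>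
  A simple process on \<open>[0, T]\<close> is \<open>\<Sum>i<n. \<xi> i * indicator {\<tau> i<..\<tau> (Suc i)}\<close> for a partition
  \<open>0 = \<tau> 0 < \<dots> < \<tau> n = T\<close> and bounded random variables \<open>\<xi> i\<close> measurable at time \<open>\<tau> i\<close>.
\<close>

definition simple_process ::
  "'w measure \<Rightarrow> (real \<Rightarrow> 'w measure) \<Rightarrow> real \<Rightarrow> nat \<Rightarrow> (nat \<Rightarrow> real) \<Rightarrow> (nat \<Rightarrow> 'w \<Rightarrow> real) \<Rightarrow> bool" where
  "simple_process M F T n \<tau> \<xi> \<longleftrightarrow>
     \<tau> 0 = 0 \<and> \<tau> n = T \<and>
     (\<forall>i<n. \<tau> i < \<tau> (Suc i) \<and> \<xi> i \<in> borel_measurable (F (\<tau> i)) \<and>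
            (\<exists>C. \<forall>w\<in>space M. \<bar>\<xi> i w\<bar> \<le> C))"

definition simple_val :: "nat \<Rightarrow> (nat \<Rightarrow> real) \<Rightarrow> (nat \<Rightarrow> 'w \<Rightarrow> real) \<Rightarrow> real \<Rightarrow> 'w \<Rightarrow> real" where
  "simple_val n \<tau> \<xi> s w = (\<Sum>i<n. \<xi> i w * indicator {\<tau> i<..\<tau> (Suc i)} s)"

definition simple_integral ::
  "(real \<Rightarrow> 'w \<Rightarrow> real) \<Rightarrow> nat \<Rightarrow> (nat \<Rightarrow> real) \<Rightarrow> (nat \<Rightarrow> 'w \<Rightarrow> real) \<Rightarrow> 'w \<Rightarrow> real" where
  "simple_integral W n \<tau> \<xi> w = (\<Sum>i<n. \<xi> i w * (W (\<tau> (Suc i)) w - W (\<tau> i) w))"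

text \<open>
  \<open>ito_integral M F W H T I\<close>: the random variable \<open>I\<close> is (a version of) the It\^o integral of \<open>H\<close>
  against \<open>W\<close> over \<open>[0, T]\<close>.  Here \<open>H\<close> is progressively measurable and almost surely square
  integrable in time, and \<open>I\<close> is the limit in probability of the integrals of simple processes
  \<open>H\<^sub>k\<close> such that the time integrals of \<open>(H\<^sub>k - H)\<^sup>2\<close> converge to 0 in probability.
\<close>

definition ito_integral ::
  "'w measure \<Rightarrow> (real \<Rightarrow> 'w measure) \<Rightarrow> (real \<Rightarrow> 'w \<Rightarrow> real) \<Rightarrow> (real \<Rightarrow> 'w \<Rightarrow> real) \<Rightarrow>
    real \<Rightarrow> ('w \<Rightarrow> real) \<Rightarrow> bool" where
  "ito_integral M F W H T I \<longleftrightarrow>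
     (\<forall>t\<in>{0..T}. (\<lambda>(s, w). H s w) \<in> borel_measurable (restrict_space borel {0..t} \<Otimes>\<^sub>M F t)) \<and>
     (AE w in M. (\<integral>\<^sup>+s\<in>{0..T}. ennreal ((H s w)\<^sup>2) \<partial>lborel) < \<infinity>) \<and>
     I \<in> borel_measurable M \<and>
     (\<exists>n \<tau> \<xi>.
        (\<forall>k::nat. simple_process M F T (n k) (\<tau> k) (\<xi> k)) \<and>
        (\<forall>\<epsilon>>0. (\<lambda>k. measure M {w \<in> space M.
            ennreal \<epsilon> < (\<integral>\<^sup>+s\<in>{0..T}. ennreal ((simple_val (n k) (\<tau> k) (\<xi> k) s w - H s w)\<^sup>2) \<partial>lborel)})
          \<longlonglongrightarrow> 0) \<and>
        (\<forall>\<epsilon>>0. (\<lambda>k. measure M {w \<in> space M. \<epsilon> < \<bar>simple_integral W (n k) (\<tau> k) (\<xi> k) w - I w\<bar>})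
          \<longlonglongrightarrow> 0))"

text \<open>
  \<open>X\<close> solves \<open>dX = a(X, t) dt + \<sigma>(X, t) dW\<close> on \<open>[0, \<infinity>)\<close>, with arbitrary initial value \<open>X 0\<close>.
\<close>

definition sde_solution ::
  "'w measure \<Rightarrow> (real \<Rightarrow> 'w measure) \<Rightarrow> (real \<Rightarrow> 'w \<Rightarrow> real) \<Rightarrow>
    (real \<Rightarrow> real \<Rightarrow> real) \<Rightarrow> (real \<Rightarrow> real \<Rightarrow> real) \<Rightarrow> (real \<Rightarrow> 'w \<Rightarrow> real) \<Rightarrow> bool" where
  "sde_solution M F W a \<sigma> X \<longleftrightarrow>
     standard_brownian_motion M F W \<and> adapted_continuous M F X \<and>
     (\<forall>T\<ge>0. ito_integral M F W (\<lambda>s w. \<sigma> (X s w) s) T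
               (\<lambda>w. X T w - X 0 w - (LINT s:{0..T}|lborel. a (X s w) s)))"


section \<open>Fokker-Planck equation and regularity\<close>

definition fokker_planck ::
  "(real \<Rightarrow> real \<Rightarrow> real) \<Rightarrow> (real \<Rightarrow> real \<Rightarrow> real) \<Rightarrow> (real \<Rightarrow> real \<Rightarrow> real) \<Rightarrow> bool" where
  "fokker_planck a b p \<longleftrightarrow>
     (\<forall>x. \<forall>t>0. ((\<lambda>s. p x s) has_real_derivative
        (- deriv (\<lambda>y. a y t * p y t) x + 1/2 * deriv (deriv (\<lambda>y. b y t * p y t)) x)) (at t))"

definition diff_under_integral :: "(real \<Rightarrow> real \<Rightarrow> real) \<Rightarrow> real \<Rightarrow> bool" where
  "diff_under_integral f t \<longleftrightarrow>
     (\<forall>\<^sub>F s in nhds t. integrable lborel (\<lambda>x. f x s)) \<and>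
     integrable lborel (\<lambda>x. deriv (f x) t) \<and>
     ((\<lambda>s. \<integral>x. f x s \<partial>lborel) has_real_derivative (\<integral>x. deriv (f x) t \<partial>lborel)) (at t)"

text \<open>
  The two integrals over the line in \<open>\<integral>u' v = [u v] - \<integral>u v'\<close> converge and the boundary term vanishes.
\<close>

definition zero_boundary_parts :: "(real \<Rightarrow> real) \<Rightarrow> (real \<Rightarrow> real) \<Rightarrow> bool" where
  "zero_boundary_parts u v \<longleftrightarrow>
     integrable lborel (\<lambda>x. deriv u x * v x) \<and> integrable lborel (\<lambda>x. u x * deriv v x) \<and>
     ((\<lambda>x. u x * v x) \<longlongrightarrow> 0) at_top \<and> ((\<lambda>x. u x * v x) \<longlongrightarrow> 0) at_bot"


section \<open>Kullback-Leibler divergence and relative Fisher information\<close>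

definition KL :: "(real \<Rightarrow> real) \<Rightarrow> (real \<Rightarrow> real) \<Rightarrow> real" where
  "KL p q = (\<integral>x. p x * ln (p x / q x) \<partial>lborel)"

lemma KL_eq_KL_divergence:
  assumes "p \<in> borel_measurable lborel" "q \<in> borel_measurable lborel"
    and "\<And>x. p x > 0" "\<And>x. q x > 0"
  shows "KL p q = KL_divergence (exp 1) (density lborel q) (density lborel p)"
proof -
  have "KL_divergence (exp 1) (density lborel q) (density lborel p)
      = (\<integral>x. p x * log (exp 1) (p x / q x) \<partial>lborel)"
    using assms by (intro lborel.KL_density_density) (auto simp: less_imp_le less_imp_neq[symmetric])
  then show ?thesis
    by (simp add: KL_def log_def)
qed

definition rel_fisher :: "(real \<Rightarrow> real) \<Rightarrow> (real \<Rightarrow> real) \<Rightarrow> (real \<Rightarrow> real) \<Rightarrow> real" where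
  "rel_fisher \<beta> p q = (\<integral>x. p x * \<beta> x * (deriv (\<lambda>y. ln (p y / q y)) x)\<^sup>2 \<partial>lborel)"

end

theory Submission
  imports Defs
begin

text \<open>
  With \<open>L = ln (p / q)\<close> and \<open>R = p / q\<close> one has
  \<open>\<partial>\<^sub>t (p L) = (\<partial>\<^sub>t p) L + \<partial>\<^sub>t p - (\<partial>\<^sub>t q) R\<close>.  The middle term integrates to 0 since \<open>p\<close> has
  constant mass.  Inserting the Fokker-Planck equation into the other two terms and integrating by
  parts once leaves \<open>a p L' - 1/2 (b p)' L' - a q R' + 1/2 (b q)' R'\<close>.  Since \<open>p L' = q R'\<close>, the
  drift terms cancel, and as \<open>b p = (b q) R\<close> the rest is \<open>- 1/2 b p L'\<^sup>2\<close>.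
\<close>

section \<open>Integration by parts on the real line\<close>

text \<open>By the fundamental theorem of calculus the integral over \<open>[-n, n]\<close> is
  \<open>F n - F (- n)\<close>, which tends to 0. Dominated convergence with bound
  \<open>\<bar>f\<bar>\<close> identifies the same limit as the integral over the line.\<close>

lemma integral_deriv_eq_zero:
  fixes F f :: "real \<Rightarrow> real"
  assumes der: "\<And>x. (F has_real_derivative f x) (at x)"
    and int: "integrable lborel f"
    and top: "(F \<longlongrightarrow> 0) at_top" and bot: "(F \<longlongrightarrow> 0) at_bot"
  shows "(\<integral>x. f x \<partial>lborel) = 0"
proof -
  have ftc: "(LINT x:{- real n..real n}|lborel. f x) = F (real n) - F (- real n)" for n
  proof -
    have "(f has_integral (F (real n) - F (- real n))) {- real n..real n}"
      by (intro fundamental_theorem_of_calculus)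
         (simp_all add: has_field_derivative_at_within[OF der]
           flip: has_real_derivative_iff_has_vector_derivative)
    moreover have "set_integrable lborel {- real n..real n} f"
      by (rule set_integrable_subset[where A = UNIV]) (use int in \<open>auto simp: set_integrable_def\<close>)
    ultimately show ?thesis
      by (simp add: set_borel_integral_eq_integral(2) integral_unique)
  qed
  have "(\<lambda>n. LINT x:{- real n..real n}|lborel. f x) \<longlonglongrightarrow> (\<integral>x. f x \<partial>lborel)"
    unfolding set_lebesgue_integral_def
  proof (rule integral_dominated_convergence[where w = "\<lambda>x. \<bar>f x\<bar>"])
    show "AE x in lborel. (\<lambda>n. indicat_real {- real n..real n} x *\<^sub>R f x) \<longlonglongrightarrow> f x"
    proof (rule AE_I2)
      fix x
      obtain N where "\<bar>x\<bar> \<le> real N"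
        using real_arch_simple by blast
      then have "\<forall>\<^sub>F n in sequentially. indicat_real {- real n..real n} x *\<^sub>R f x = f x"
        by (intro eventually_sequentiallyI[of N]) (auto simp: indicator_def)
      then show "(\<lambda>n. indicat_real {- real n..real n} x *\<^sub>R f x) \<longlonglongrightarrow> f x"
        by (rule tendsto_eventually)
    qed
  qed (use int in \<open>auto simp: indicator_def\<close>)
  moreover have "(\<lambda>n. LINT x:{- real n..real n}|lborel. f x) \<longlonglongrightarrow> 0 - 0"
    unfolding ftc
    by (rule tendsto_diff[OF filterlim_compose[OF top filterlim_real_sequentially]
          filterlim_compose[OF bot filterlim_compose[OF filterlim_uminus_at_bot_at_top
            filterlim_real_sequentially]]])
  ultimately show ?thesis
    using LIMSEQ_unique by (metis diff_zero)
qed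

text \<open>The product \<open>u v\<close> vanishes at both ends, so its derivative integrates to 0,
  and integrability of the two summands allows splitting. Explicit \<open>u'\<close> and
  \<open>v'\<close> replace \<open>deriv\<close>, so that the results can be used for rewriting with
  closed forms.\<close>

lemma zero_boundary_parts_integral:
  assumes parts: "zero_boundary_parts u v"
    and u: "\<And>x. (u has_real_derivative u' x) (at x)"
    and v: "\<And>x. (v has_real_derivative v' x) (at x)"
  shows "integrable lborel (\<lambda>x. u' x * v x)" "integrable lborel (\<lambda>x. u x * v' x)"
    "(\<integral>x. u' x * v x \<partial>lborel) = - (\<integral>x. u x * v' x \<partial>lborel)"
proof -
  have d: "deriv u = u'" "deriv v = v'"
    using DERIV_imp_deriv[OF u] DERIV_imp_deriv[OF v] by auto
  show i: "integrable lborel (\<lambda>x. u' x * v x)" "integrable lborel (\<lambda>x. u x * v' x)"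
    using parts by (auto simp: zero_boundary_parts_def d)
  have "(\<integral>x. u' x * v x + u x * v' x \<partial>lborel) = 0"
  proof (rule integral_deriv_eq_zero)
    show "((\<lambda>x. u x * v x) has_real_derivative u' x * v x + u x * v' x) (at x)" for x
      using DERIV_mult[OF u v, of x] by (simp add: mult.commute)
  qed (use parts i in \<open>auto simp: zero_boundary_parts_def\<close>)
  then show "(\<integral>x. u' x * v x \<partial>lborel) = - (\<integral>x. u x * v' x \<partial>lborel)"
    using i by simp
qed

section \<open>Partial derivatives in the space variable\<close>

text \<open>The partial derivative in the first variable is the Frechet derivative in the direction
  \<open>(1, 0)\<close>. Restricted to the horizontal line at height \<open>t\<close>, which lies in
  \<open>UNIV \<times> T\<close>, it is a two-sided derivative even if \<open>t\<close> is a
  boundary point of \<open>T\<close>.\<close>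

lemma C_on_Suc_slice:
  fixes f :: "real \<times> real \<Rightarrow> real"
  assumes "C_on (Suc k) (UNIV \<times> T) f" "t \<in> T"
  obtains g where "C_on k (UNIV \<times> T) g" "\<And>x. ((\<lambda>y. f (y, t)) has_real_derivative g (x, t)) (at x)"
proof
  let ?g = "\<lambda>z. frechet_derivative f (at z within UNIV \<times> T) (1, 0)"
  show "C_on k (UNIV \<times> T) ?g"
    using assms by simp
  fix x
  let ?D = "frechet_derivative f (at (x, t) within UNIV \<times> T)"
  have D: "(f has_derivative ?D) (at (x, t) within UNIV \<times> T)"
    using assms by (auto simp: differentiable_on_def frechet_derivative_works)
  have "((\<lambda>y. (y, t)) has_derivative (\<lambda>h. (h, 0))) (at x)"
    by (auto intro!: derivative_eq_intros)
  moreover have "(f has_derivative ?D) (at (x, t) within (\<lambda>y. (y, t)) ` UNIV)"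
    using assms(2) by (intro has_derivative_subset[OF D]) auto
  ultimately have "((\<lambda>y. f (y, t)) has_derivative (\<lambda>h. ?D (h, 0))) (at x)"
    by (rule has_derivative_in_compose)
  \<comment> \<open>By linearity the derivative along the line is multiplication by its value at
    \<open>(1, 0)\<close>.\<close>
  moreover have "?D (h, 0) = ?g (x, t) * h" for h
    using linear_cmul[OF has_derivative_linear[OF D], of h "(1, 0)"] by (simp add: mult.commute)
  then have "(\<lambda>h. ?D (h, 0)) = (*) (?g (x, t))"
    by blast
  ultimately show "((\<lambda>y. f (y, t)) has_real_derivative ?g (x, t)) (at x)"
    by (simp only: has_field_derivative_def)
qed

text \<open>Supplies the two space derivatives that the second-order term of the Fokker-Planck
  equation calls for.\<close>

lemma smooth_on_slice:
  fixes f :: "real \<Rightarrow> real \<Rightarrow> real"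
  assumes "smooth_on (UNIV \<times> T) (\<lambda>(x, t). f x t)" "t \<in> T"
  obtains f1 f2 where
    "\<And>x. ((\<lambda>y. f y t) has_real_derivative f1 x) (at x)"
    "\<And>x. (f1 has_real_derivative f2 x) (at x)"
proof -
  have C2: "C_on (Suc (Suc 0)) (UNIV \<times> T) (\<lambda>(x, t). f x t)"
    using assms(1) unfolding smooth_on_def by blast
  obtain g where g: "C_on (Suc 0) (UNIV \<times> T) g"
      "\<And>x. ((\<lambda>y. (\<lambda>(x, t). f x t) (y, t)) has_real_derivative g (x, t)) (at x)"
    using C_on_Suc_slice[OF C2 assms(2)] by blast
  obtain h where "\<And>x. ((\<lambda>y. g (y, t)) has_real_derivative h (x, t)) (at x)"
    using C_on_Suc_slice[OF g(1) assms(2)] by blast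
  then show thesis
    using that[of "\<lambda>x. g (x, t)" "\<lambda>x. h (x, t)"] g(2) by simp
qed

lemma integral_distributed_density:
  assumes "prob_space M" "distributed M lborel X (\<lambda>x. ennreal (f x))"
    and "integrable lborel f" "\<And>x. f x \<ge> 0"
  shows "(\<integral>x. f x \<partial>lborel) = 1"
proof -
  interpret prob_space M by fact
  have "(\<integral>\<^sup>+x. ennreal (f x) \<partial>lborel) = emeasure (density lborel (\<lambda>x. ennreal (f x))) UNIV"
    using assms(3) by (simp add: emeasure_density)
  also have "\<dots> = emeasure (distr M lborel X) (space (distr M lborel X))"
    using assms(2) by (simp add: distributed_def)
  also have "\<dots> = 1"
    using assms(2) by (intro prob_space.emeasure_space_1 prob_space_distr) (simp add: distributed_def)
  finally show ?thesis
    using assms(3,4) by (simp add: integral_eq_nn_integral)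
qed

theorem theorem6:
  fixes a \<sigma> b p q :: "real \<Rightarrow> real \<Rightarrow> real"
    and M :: "'w measure" and F :: "real \<Rightarrow> 'w measure" and W X :: "real \<Rightarrow> 'w \<Rightarrow> real"
    and M' :: "'v measure" and F' :: "real \<Rightarrow> 'v measure" and W' Y :: "real \<Rightarrow> 'v \<Rightarrow> real"
    and t :: real
  assumes a_smooth: "smooth_on (UNIV \<times> {0..}) (\<lambda>(x, t). a x t)"
    and \<sigma>_smooth: "smooth_on (UNIV \<times> {0..}) (\<lambda>(x, t). \<sigma> x t)"
    and \<sigma>_pos: "\<And>x t. t \<ge> 0 \<Longrightarrow> \<sigma> x t > 0"
    and b_def: "\<And>x t. b x t = (\<sigma> x t)\<^sup>2"
    and X_sde: "sde_solution M F W a \<sigma> X"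
    and Y_sde: "sde_solution M' F' W' a \<sigma> Y"
    and p_density: "\<And>t. t > 0 \<Longrightarrow> distributed M lborel (X t) (\<lambda>x. ennreal (p x t))"
    and q_density: "\<And>t. t > 0 \<Longrightarrow> distributed M' lborel (Y t) (\<lambda>x. ennreal (q x t))"
    and p_pos: "\<And>x t. t > 0 \<Longrightarrow> p x t > 0"
    and q_pos: "\<And>x t. t > 0 \<Longrightarrow> q x t > 0"
    and p_smooth: "smooth_on (UNIV \<times> {0<..}) (\<lambda>(x, t). p x t)"
    and q_smooth: "smooth_on (UNIV \<times> {0<..}) (\<lambda>(x, t). q x t)"
    and p_fokker_planck: "fokker_planck a b p"
    and q_fokker_planck: "fokker_planck a b q"
    and diff_p: "\<And>t. t > 0 \<Longrightarrow> diff_under_integral p t"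
    and diff_p_log: "\<And>t. t > 0 \<Longrightarrow> diff_under_integral (\<lambda>x s. p x s * ln (p x s / q x s)) t"
    and parts_a_p: "\<And>t. t > 0 \<Longrightarrow>
      zero_boundary_parts (\<lambda>x. a x t * p x t) (\<lambda>x. ln (p x t / q x t))"
    and parts_b_p: "\<And>t. t > 0 \<Longrightarrow>
      zero_boundary_parts (deriv (\<lambda>x. b x t * p x t)) (\<lambda>x. ln (p x t / q x t))"
    and parts_a_q: "\<And>t. t > 0 \<Longrightarrow>
      zero_boundary_parts (\<lambda>x. a x t * q x t) (\<lambda>x. p x t / q x t)"
    and parts_b_q: "\<And>t. t > 0 \<Longrightarrow>
      zero_boundary_parts (deriv (\<lambda>x. b x t * q x t)) (\<lambda>x. p x t / q x t)"
    and t_pos: "t > 0"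
  shows "((\<lambda>s. KL (\<lambda>x. p x s) (\<lambda>x. q x s)) has_real_derivative
           - 1/2 * rel_fisher (\<lambda>x. b x t) (\<lambda>x. p x t) (\<lambda>x. q x t)) (at t)"
proof -
  have "prob_space M"
    using X_sde
    by (simp add: sde_solution_def standard_brownian_motion_def filtered_prob_space_def)
  \<comment> \<open>Stated for all \<open>s > 0\<close>, because differentiating the mass at
    \<open>t\<close> needs its value on a neighbourhood of \<open>t\<close>.\<close>
  have mass: "(\<integral>x. p x s \<partial>lborel) = 1" if "s > 0" for s
    using \<open>prob_space M\<close> p_density[OF that] diff_p[OF that] p_pos[OF that]
    by (intro integral_distributed_density[of M "X s"])
       (auto simp: diff_under_integral_def less_imp_le dest: eventually_nhds_x_imp_x)

  \<comment> \<open>Space derivatives of coefficients, densities and their ratios\<close>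
  obtain A1 A2 where A: "\<And>x. ((\<lambda>y. a y t) has_real_derivative A1 x) (at x)"
      "\<And>x. (A1 has_real_derivative A2 x) (at x)"
    using smooth_on_slice[OF a_smooth, of t] t_pos by auto
  obtain S1 S2 where S: "\<And>x. ((\<lambda>y. \<sigma> y t) has_real_derivative S1 x) (at x)"
      "\<And>x. (S1 has_real_derivative S2 x) (at x)"
    using smooth_on_slice[OF \<sigma>_smooth, of t] t_pos by auto
  obtain P1 P2 where P: "\<And>x. ((\<lambda>y. p y t) has_real_derivative P1 x) (at x)"
      "\<And>x. (P1 has_real_derivative P2 x) (at x)"
    using smooth_on_slice[OF p_smooth, of t] t_pos by auto
  obtain Q1 Q2 where Q: "\<And>x. ((\<lambda>y. q y t) has_real_derivative Q1 x) (at x)"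
      "\<And>x. (Q1 has_real_derivative Q2 x) (at x)"
    using smooth_on_slice[OF q_smooth, of t] t_pos by auto

  have [simp]: "p x t > 0" "q x t > 0" "p x t \<noteq> 0" "q x t \<noteq> 0" for x
    using p_pos[OF t_pos, of x] q_pos[OF t_pos, of x] by auto

  define B1 where "B1 = (\<lambda>x. 2 * \<sigma> x t * S1 x)"
  define B2 where "B2 = (\<lambda>x. 2 * (S1 x * S1 x + \<sigma> x t * S2 x))"
  have B: "((\<lambda>y. b y t) has_real_derivative B1 x) (at x)"
      "(B1 has_real_derivative B2 x) (at x)" for x
    unfolding b_def B1_def B2_def
    by (auto intro!: derivative_eq_intros S simp: algebra_simps)

  \<comment> \<open>The closed forms of \<open>L'\<close> and \<open>R'\<close> turn the final
    pointwise comparison into an identity of rational expressions.\<close>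
  define L1 where "L1 = (\<lambda>x. P1 x / p x t - Q1 x / q x t)"
  define R1 where "R1 = (\<lambda>x. (P1 x * q x t - p x t * Q1 x) / (q x t * q x t))"
  have L: "((\<lambda>y. ln (p y t / q y t)) has_real_derivative L1 x) (at x)" for x
    unfolding L1_def by (auto intro!: derivative_eq_intros P Q simp: field_simps)
  have R: "((\<lambda>y. p y t / q y t) has_real_derivative R1 x) (at x)" for x
    unfolding R1_def by (auto intro!: derivative_eq_intros P Q)

  define AP1 where "AP1 = (\<lambda>x. A1 x * p x t + P1 x * a x t)"
  have ap: "((\<lambda>y. a y t * p y t) has_real_derivative AP1 x) (at x)" for x
    unfolding AP1_def by (rule DERIV_mult[OF A(1) P(1)])
  define AQ1 where "AQ1 = (\<lambda>x. A1 x * q x t + Q1 x * a x t)"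
  have aq: "((\<lambda>y. a y t * q y t) has_real_derivative AQ1 x) (at x)" for x
    unfolding AQ1_def by (rule DERIV_mult[OF A(1) Q(1)])

  define BP1 where "BP1 = (\<lambda>x. B1 x * p x t + P1 x * b x t)"
  define BP2 where "BP2 = (\<lambda>x. B2 x * p x t + 2 * B1 x * P1 x + P2 x * b x t)"
  define BQ1 where "BQ1 = (\<lambda>x. B1 x * q x t + Q1 x * b x t)"
  define BQ2 where "BQ2 = (\<lambda>x. B2 x * q x t + 2 * B1 x * Q1 x + Q2 x * b x t)"
  have bp: "((\<lambda>y. b y t * p y t) has_real_derivative BP1 x) (at x)"
      "(BP1 has_real_derivative BP2 x) (at x)" for x
    unfolding BP1_def BP2_def
    by (auto intro!: derivative_eq_intros B P simp: algebra_simps)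
  have bq: "((\<lambda>y. b y t * q y t) has_real_derivative BQ1 x) (at x)"
      "(BQ1 has_real_derivative BQ2 x) (at x)" for x
    unfolding BQ1_def BQ2_def
    by (auto intro!: derivative_eq_intros B Q simp: algebra_simps)
  \<comment> \<open>These rewrite the boundary assumptions on \<open>b p\<close> and
    \<open>b q\<close> so that \<open>BP1\<close> and \<open>BQ1\<close> appear as the factor
    \<open>u\<close>, whose derivatives are \<open>BP2\<close> and \<open>BQ2\<close>.\<close>
  have [simp]: "deriv (\<lambda>y. b y t * p y t) = BP1" "deriv (\<lambda>y. b y t * q y t) = BQ1"
    using bp(1) bq(1) by (auto intro!: DERIV_imp_deriv)

  \<comment> \<open>Time derivatives of the densities and of the integrand\<close>
  have pt: "((\<lambda>s. p x s) has_real_derivative - AP1 x + 1/2 * BP2 x) (at t)" for x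
  proof -
    have "((\<lambda>s. p x s) has_real_derivative
        - deriv (\<lambda>y. a y t * p y t) x + 1/2 * deriv (deriv (\<lambda>y. b y t * p y t)) x) (at t)"
      using p_fokker_planck t_pos unfolding fokker_planck_def by blast
    then show ?thesis
      using DERIV_imp_deriv[OF ap] DERIV_imp_deriv[OF bp(2)] by simp
  qed
  have qt: "((\<lambda>s. q x s) has_real_derivative - AQ1 x + 1/2 * BQ2 x) (at t)" for x
  proof -
    have "((\<lambda>s. q x s) has_real_derivative
        - deriv (\<lambda>y. a y t * q y t) x + 1/2 * deriv (deriv (\<lambda>y. b y t * q y t)) x) (at t)"
      using q_fokker_planck t_pos unfolding fokker_planck_def by blast
    then show ?thesis
      using DERIV_imp_deriv[OF aq] DERIV_imp_deriv[OF bq(2)] by simp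
  qed

  note IaP = zero_boundary_parts_integral[OF parts_a_p[OF t_pos] ap L]
  note IbP = zero_boundary_parts_integral[OF parts_b_p[OF t_pos, simplified] bp(2) L]
  note IaQ = zero_boundary_parts_integral[OF parts_a_q[OF t_pos] aq R]
  note IbQ = zero_boundary_parts_integral[OF parts_b_q[OF t_pos, simplified] bq(2) R]

  have dp: "deriv (p x) t = - AP1 x + 1/2 * BP2 x" for x
    using DERIV_imp_deriv[OF pt] by simp
  have Ip: "integrable lborel (\<lambda>x. deriv (p x) t)"
    using diff_p[OF t_pos] by (simp add: diff_under_integral_def)
  \<comment> \<open>Near \<open>t\<close> the mass is the constant 1, so its derivative, obtained
    under the integral sign, must equal 0.\<close>
  have "((\<lambda>s. 1) has_real_derivative (\<integral>x. deriv (p x) t \<partial>lborel)) (at t)"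
  proof (rule DERIV_cong_ev[THEN iffD1, rotated -1])
    show "((\<lambda>s. \<integral>x. p x s \<partial>lborel) has_real_derivative (\<integral>x. deriv (p x) t \<partial>lborel)) (at t)"
      using diff_p[OF t_pos] by (simp add: diff_under_integral_def)
    show "\<forall>\<^sub>F s in nhds t. (\<integral>x. p x s \<partial>lborel) = 1"
      using eventually_nhds_in_open[of "{0<..}" t] t_pos
      by (auto elim!: eventually_mono simp: mass)
  qed simp_all
  then have p0: "(\<integral>x. deriv (p x) t \<partial>lborel) = 0"
    using DERIV_unique DERIV_const by blast

  \<comment> \<open>Differentiating \<open>ln (p / q)\<close> in time and multiplying by
    \<open>p\<close> gives \<open>?p' - ?q' R\<close>. Its first part is kept as
    \<open>deriv (p x) t\<close>: this is known to be integrable with integral 0 as a whole, while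
    nothing is assumed about \<open>AP1\<close> and \<open>BP2\<close> separately.\<close>
  have dKL: "deriv (\<lambda>s. p x s * ln (p x s / q x s)) t =
      - (AP1 x * ln (p x t / q x t)) + 1/2 * (BP2 x * ln (p x t / q x t)) + deriv (p x) t
      + AQ1 x * (p x t / q x t) - 1/2 * (BQ2 x * (p x t / q x t))" for x
  proof -
    let ?p' = "- AP1 x + 1/2 * BP2 x" and ?q' = "- AQ1 x + 1/2 * BQ2 x"
    have "((\<lambda>s. p x s / q x s) has_real_derivative
        (?p' * q x t - p x t * ?q') / (q x t * q x t)) (at t)"
      by (rule DERIV_divide[OF pt qt]) simp
    then have "((\<lambda>s. ln (p x s / q x s)) has_real_derivative
        1 / (p x t / q x t) * ((?p' * q x t - p x t * ?q') / (q x t * q x t))) (at t)"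
      by (rule DERIV_chain2[rotated]) (rule DERIV_ln_divide, simp)
    then have "deriv (\<lambda>s. p x s * ln (p x s / q x s)) t = ?p' * ln (p x t / q x t)
        + 1 / (p x t / q x t) * ((?p' * q x t - p x t * ?q') / (q x t * q x t)) * p x t"
      by (intro DERIV_imp_deriv DERIV_mult pt)
    also have "1 / (p x t / q x t) * ((?p' * q x t - p x t * ?q') / (q x t * q x t)) * p x t
        = ?p' - ?q' * (p x t / q x t)"
      by (simp add: divide_simps)
    finally show ?thesis
      unfolding dp by (simp add: algebra_simps)
  qed

  \<comment> \<open>Integration of the time derivative and cancellation\<close>
  \<comment> \<open>The summands have the shape of \<open>dKL\<close>, so that one rewrite splits
    the integral into pieces, each with its own integrability fact.\<close>
  have lin: "(\<integral>x. - f1 x + 1/2 * f2 x + f3 x + f4 x - 1/2 * f5 x \<partial>lborel) =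
      - (\<integral>x. f1 x \<partial>lborel) + 1/2 * (\<integral>x. f2 x \<partial>lborel) + (\<integral>x. f3 x \<partial>lborel)
      + (\<integral>x. f4 x \<partial>lborel) - 1/2 * (\<integral>x. f5 x \<partial>lborel)"
    if "integrable lborel f1" "integrable lborel f2" "integrable lborel f3"
      "integrable lborel f4" "integrable lborel f5" for f1 f2 f3 f4 f5 :: "real \<Rightarrow> real"
    using that by simp
  have "(\<integral>x. deriv (\<lambda>s. p x s * ln (p x s / q x s)) t \<partial>lborel) =
      (\<integral>x. a x t * p x t * L1 x \<partial>lborel) - 1/2 * (\<integral>x. BP1 x * L1 x \<partial>lborel)
      - (\<integral>x. a x t * q x t * R1 x \<partial>lborel) + 1/2 * (\<integral>x. BQ1 x * R1 x \<partial>lborel)"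
    unfolding dKL lin[OF IaP(1) IbP(1) Ip IaQ(1) IbQ(1)] IaP(3) IbP(3) IaQ(3) IbQ(3) p0 by simp
  \<comment> \<open>Back under one integral, where the cancellations are pointwise.\<close>
  also have "\<dots> = (\<integral>x. a x t * p x t * L1 x - 1/2 * (BP1 x * L1 x)
      - a x t * q x t * R1 x + 1/2 * (BQ1 x * R1 x) \<partial>lborel)"
    using IaP(2) IbP(2) IaQ(2) IbQ(2) by simp
  also have "\<dots> = (\<integral>x. - 1/2 * (p x t * b x t * (L1 x)\<^sup>2) \<partial>lborel)"
  proof (rule Bochner_Integration.integral_cong[OF refl])
    fix x
    have PL: "p x t * L1 x = q x t * R1 x"
      by (simp add: L1_def R1_def field_simps)
    \<comment> \<open>Since \<open>p L1 = q R1\<close>, the \<open>B1\<close> terms cancel, leaving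
      \<open>b (P1 L1 - Q1 R1) = b p L1 (P1 / p - Q1 / q)\<close>, whose last factor is again
      \<open>L1\<close>.\<close>
    have "BP1 x * L1 x - BQ1 x * R1 x = p x t * b x t * (L1 x)\<^sup>2"
      by (simp add: L1_def R1_def BP1_def BQ1_def field_simps power2_eq_square)
    moreover have "a x t * p x t * L1 x = a x t * q x t * R1 x"
      using PL by (simp add: mult.assoc)
    ultimately show "a x t * p x t * L1 x - 1/2 * (BP1 x * L1 x)
        - a x t * q x t * R1 x + 1/2 * (BQ1 x * R1 x) = - 1/2 * (p x t * b x t * (L1 x)\<^sup>2)"
      by linarith
  qed
  also have "\<dots> = - 1/2 * rel_fisher (\<lambda>x. b x t) (\<lambda>x. p x t) (\<lambda>x. q x t)"
    using DERIV_imp_deriv[OF L] by (simp add: rel_fisher_def)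
  finally show ?thesis
    using diff_p_log[OF t_pos] by (simp add: diff_under_integral_def KL_def)
qed

end
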